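(* Let $(X,V,W,S,\mathcal H_*,h,*,\Theta)$ satisfy the abstract symmetrization framework described in the context. Let $f,f_h:X\to\mathbb R\cup\{+\infty\}$ ($h\in\mathbb N$) be proper lower semi-continuous functionals bounded from below such that: (i) for any $u\in\mathrm{dom}(f)\cap S$ there is a sequence $(u_h)\subset S$ with $u_h\to u$ in $X$ and $f_h(u_h)\to f(u)$; (ii) $\liminf_h\big(\inf_X f_h\big)\ge\inf_X f$; (iii) $f_h(u^H)\le f_h(u)$ for all $u\in S$, $H\in\mathcal H_*$ and $h\in\mathbb N$. Let $Y$ be a nonempty subset of $S$ and let $\rho>0$, $\sigma>0$ be such that $\inf_Y f<\inf_X f+\sigma\rho$. Then, for every $h_0\ge1$ there exist $h\ge h_0$, $m>1$, $u_h\in S$ and $v_h\in X$ such that: (a) $\|v_h-v_h^*\|_V<(K(C_\Theta+1)+1)\rho$; (b) $|f_h(v_h)-\inf_X f|<\sigma\rho$; (c) $d(v_h,Y)<\rho+\|\mathbb T_{(m-1)\rho/m}u_h-u_h\|$; (d) $f_h(w)\ge f_h(v_h)-\sigma\|w-v_h\|$ for all $w\in X$. In particular, if $f_h=f$ for all $h\in\mathbb N$ and $Y\subset X_{\mathcal H_*}$, where $X_{\mathcal H_*}:=\{u\in S: u^H=u\text{ for all }H\in\mathcal H_*\}$, there exists $v\in X$ such that: (a) $\|v-v^*\|_V<(K(C_\Theta+1)+1)\rho$; (b) $|f(v)-\inf_X f|<\sigma\rho$; (c) $d(v,Y)<\rho$; (d) $f(w)\ge f(v)-\sigma\|w-v\|$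 for all $w\in X$.
   Context: Abstract framework. $X,V,W$ are real Banach spaces with $X\subseteq V\subseteq W$, $X$ continuously embedded in $V$ and $V$ continuously embedded in $W$; $\|\cdot\|$ is the norm of $X$ and $K>0$ is a continuity constant of $X\hookrightarrow V$, i.e. $\|u\|_V\le K\|u\|$ for $u\in X$. $S\subseteq X$ carries the metric induced by $\|\cdot\|$, $\mathcal H_*$ is a path-connected topological space, and there are maps $*:S\to S$, $u\mapsto u^*$ (symmetrization) and $h:S\times\mathcal H_*\to S$, $(u,H)\mapsto u^H$ (polarization; not to be confused with the index $h\in\mathbb N$) such that: the polarization map is continuous; $(u^* )^H=(u^H)^*=u^*$ and $(u^H)^H=u^H$ for all $u\in S$, $H\in\mathcal H_*$; there is a sequence $(H_m)\subset\mathcal H_*$ such that for every $u\in S$ the iterated polarizations $u^{H_1\cdots H_m}$ converge to $u^*$ in $V$ as $m\to\infty$; $\|u^H-v^H\|_V\le\|u-v\|_V$ for all $u,v\in S$, $H\in\mathcal H_*$. Moreover $\Theta:(X,\|\cdot\|_V)\to(S,\|\cdot\|_V)$ is Lipschitz with constant $C_\Theta>0$ and $\Theta|_S=\mathrm{Id}|_S$; for $u\in X$ one sets $u^H:=(\Theta(u))^H$ and $u^*:=(\Theta(u))^*$. For every $\rho>0$, $\mathbb T_\rho:S\to S$ denotes a continuous map such that, for every $u\in S$, $\mathbb T_\rho u$ is obtained from $u$ by finitely many iterated polarizations by elements of $\mathcal H_*$, and $\|\mathbb T_\rho u-u^*\|_V<\rho$ (such maps are known to exist in this framework). $\mathrm{dom}(f)=\{u\in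 X: f(u)<+\infty\}$; proper means $\mathrm{dom}(f)\ne\emptyset$; $d(v,Y)=\inf_{y\in Y}\|v-y\|$. *)

theory Defs
  imports "HOL-Analysis.Analysis"
begin

(* u^{H_1 ... H_m} = (...((u^{H_1})^{H_2})...)^{H_m}: the head of the list acts first. *)
definition iterated_polarization :: "('x \<Rightarrow> 'h \<Rightarrow> 'x) \<Rightarrow> 'x \<Rightarrow> 'h list \<Rightarrow> 'x" where
  "iterated_polarization pol u Hs = foldl pol u Hs"

(* The inclusions X \<subseteq> V \<subseteq> W are the injective bounded linear maps iV and iW, so the V-norm of
   u in X is norm (iV u).  The norm, metric and topology of the type 'x are those of X.
   star and pol are total functions, but their values are specified on S (and S, HH) only;
   the extensions to all of X are star (\<Theta> u) and pol (\<Theta> u) H.  *)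
locale symmetrization_framework =
  fixes iV :: "'x::banach \<Rightarrow> 'v::banach"
    and iW :: "'v \<Rightarrow> 'w::banach"
    and K :: real
    and S :: "'x set"
    and HH :: "'h::topological_space set"
    and star :: "'x \<Rightarrow> 'x"
    and pol :: "'x \<Rightarrow> 'h \<Rightarrow> 'x"
    and \<Theta> :: "'x \<Rightarrow> 'x"
    and C\<Theta> :: real
  assumes iV: "bounded_linear iV" "inj iV"
    and iW: "bounded_linear iW" "inj iW"
    and K_pos: "K > 0"
    and K_bound: "norm (iV u) \<le> K * norm u"
    and HH_path_connected: "path_connected HH"
    and star_in_S: "u \<in> S \<Longrightarrow> star u \<in> S"
    and pol_in_S: "u \<in> S \<Longrightarrow> H \<in> HH \<Longrightarrow> pol u H \<in> S"
    and pol_continuous: "continuous_on (S \<times> HH) (\<lambda>(u, H). pol u H)"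
    and pol_star: "u \<in> S \<Longrightarrow> H \<in> HH \<Longrightarrow> pol (star u) H = star u"
    and star_pol: "u \<in> S \<Longrightarrow> H \<in> HH \<Longrightarrow> star (pol u H) = star u"
    and pol_idem: "u \<in> S \<Longrightarrow> H \<in> HH \<Longrightarrow> pol (pol u H) H = pol u H"
    and polarizations_converge:
      "\<exists>Hseq :: nat \<Rightarrow> 'h. (\<forall>m. Hseq m \<in> HH) \<and>
         (\<forall>u\<in>S. (\<lambda>m. iV (iterated_polarization pol u (map Hseq [1..<Suc m])))
                   \<longlonglongrightarrow> iV (star u))"
    and pol_contraction:
      "u \<in> S \<Longrightarrow> v \<in> S \<Longrightarrow> H \<in> HH \<Longrightarrow>
         norm (iV (pol u H) - iV (pol v H)) \<le> norm (iV u - iV v)"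
    and C\<Theta>_pos: "C\<Theta> > 0"
    and \<Theta>_in_S: "\<Theta> u \<in> S"
    and \<Theta>_lipschitz: "norm (iV (\<Theta> u) - iV (\<Theta> v)) \<le> C\<Theta> * norm (iV u - iV v)"
    and \<Theta>_id: "u \<in> S \<Longrightarrow> \<Theta> u = u"

definition symmetrization_approximation ::
  "('x::real_normed_vector \<Rightarrow> 'v::real_normed_vector) \<Rightarrow> 'x set \<Rightarrow> 'h set \<Rightarrow> ('x \<Rightarrow> 'x) \<Rightarrow>
   ('x \<Rightarrow> 'h \<Rightarrow> 'x) \<Rightarrow> (real \<Rightarrow> 'x \<Rightarrow> 'x) \<Rightarrow> bool" where
  "symmetrization_approximation iV S HH star pol T \<longleftrightarrow>
     (\<forall>\<rho>>0. T \<rho> \<in> S \<rightarrow> S \<and> continuous_on S (T \<rho>) \<and>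
        (\<forall>u\<in>S. (\<exists>Hs. set Hs \<subseteq> HH \<and> T \<rho> u = iterated_polarization pol u Hs) \<and>
                norm (iV (T \<rho> u) - iV (star u)) < \<rho>))"

definition polarization_fixed :: "'x set \<Rightarrow> 'h set \<Rightarrow> ('x \<Rightarrow> 'h \<Rightarrow> 'x) \<Rightarrow> 'x set" where
  "polarization_fixed S HH pol = {u \<in> S. \<forall>H\<in>HH. pol u H = u}"

definition dom_fin :: "('x \<Rightarrow> ereal) \<Rightarrow> 'x set" where
  "dom_fin f = {u. f u < \<infinity>}"

definition lower_semicontinuous :: "('x::topological_space \<Rightarrow> ereal) \<Rightarrow> bool" where
  "lower_semicontinuous f \<longleftrightarrow> (\<forall>u. \<forall>a < f u. eventually (\<lambda>v. a < f v) (nhds u))"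

(* The first conjunct says that f takes its values in the reals together with +infinity. *)
definition proper_lsc_bounded_below :: "('x::topological_space \<Rightarrow> ereal) \<Rightarrow> bool" where
  "proper_lsc_bounded_below f \<longleftrightarrow>
     (\<forall>u. f u \<noteq> - \<infinity>) \<and> dom_fin f \<noteq> {} \<and> lower_semicontinuous f \<and>
     (\<exists>c::real. \<forall>u. ereal c \<le> f u)"

end

theory Submission
  imports Defs
begin

text \<open>Apply Ekeland's principle to \<open>fh h\<close>, starting at \<open>T \<delta> u\<close> for a term \<open>u\<close> of a recovery
  sequence of some \<open>y \<in> Y\<close> with \<open>f y\<close> almost minimal. Polarizing does not increase \<open>fh h\<close>, so
  the starting point is still almost minimal, and it is \<open>\<delta>\<close>-close to its symmetrization. Ekeland's
  point \<open>v\<close> lies within \<open>\<delta>\<close> of it, and the asymmetry of \<open>v\<close> is controlled because \<open>star\<close>, as a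
  limit of iterated polarizations, is a contraction for the norm of \<open>V\<close>.\<close>

section \<open>Lower semicontinuity and Ekeland's principle\<close>

lemma open_superlevel_lower_semicontinuous:
  assumes "lower_semicontinuous f"
  shows "open {u. a < f u}"
proof (subst open_subopen, intro ballI)
  fix u assume "u \<in> {u. a < f u}"
  then have "eventually (\<lambda>v. a < f v) (nhds u)"
    using assms by (auto simp: lower_semicontinuous_def)
  then show "\<exists>T. open T \<and> u \<in> T \<and> T \<subseteq> {u. a < f u}"
    unfolding eventually_nhds by auto
qed

text \<open>Off the sublevel set a real \<open>b\<close> fits strictly between
  \<open>a - g u\<close> and \<open>f u\<close>, so the complement is a union of open sets. This
  makes the sets \<open>F z\<close> in Ekeland's principle closed.\<close>

lemma closed_sublevel_lower_semicontinuous_add: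
  fixes g :: "'a::topological_space \<Rightarrow> real"
  assumes lsc: "lower_semicontinuous f" and g: "continuous_on UNIV g"
  shows "closed {u. f u + ereal (g u) \<le> ereal a}"
proof -
  have "- {u. f u + ereal (g u) \<le> ereal a}
      = (\<Union>b. {u. ereal b < f u} \<inter> {u. a - b < g u})" (is "?L = ?R")
  proof (intro equalityI subsetI)
    fix u assume "u \<in> ?L"
    then have "ereal (a - g u) < f u"
      by (cases "f u") auto
    then obtain b where "ereal (a - g u) < ereal b" "ereal b < f u"
      using ereal_dense2 by blast
    then show "u \<in> ?R" by (intro UN_I[of b]) auto
  next
    fix u assume "u \<in> ?R"
    then show "u \<in> ?L" by (cases "f u") auto
  qed
  moreover have "open ?R"
    using g by (intro open_UN ballI open_Int open_superlevel_lower_semicontinuous[OF lsc]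
        open_Collect_less continuous_intros)
  ultimately show ?thesis by (simp add: closed_def)
qed

theorem ekeland_variational_principle:
  fixes f :: "'a::complete_space \<Rightarrow> ereal" and c \<sigma> :: real
  assumes lsc: "lower_semicontinuous f" and below: "\<And>u. ereal c \<le> f u"
    and x: "f x < \<infinity>" and \<sigma>: "\<sigma> > 0"
  obtains v where "f v + ereal (\<sigma> * dist v x) \<le> f x"
    and "\<And>w. w \<noteq> v \<Longrightarrow> f v < f w + ereal (\<sigma> * dist w v)"
proof -
  \<comment> \<open>\<open>F z\<close> is the set of points below \<open>z\<close> in Ekeland's
    order. The next facts give reflexivity and transitivity; the point sought is a minimal
    \<open>v\<close> below \<open>x\<close>, that is, one with \<open>F v = {v}\<close>.\<close>
  define F where "F z = {y. f y + ereal (\<sigma> * dist y z) \<le> f z}" for z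
  have F_self: "z \<in> F z" for z by (simp add: F_def)
  have F_le: "f y \<le> f z" if "y \<in> F z" for y z
    using that \<sigma> below[of y] below[of z] unfolding F_def
    by (cases "f y"; cases "f z") (auto simp: add_nonneg_nonneg intro: order_trans[rotated])
  have F_trans: "F y \<subseteq> F z" if "y \<in> F z" for y z
  proof
    fix w assume "w \<in> F y"
    moreover have "\<sigma> * dist w z \<le> \<sigma> * dist w y + \<sigma> * dist y z"
      using \<sigma> dist_triangle[of w z y] by (simp flip: distrib_left)
    ultimately show "w \<in> F z"
      using that below[of y] below[of z] below[of w] unfolding F_def
      by (cases "f y"; cases "f z"; cases "f w") auto
  qed
  \<comment> \<open>Staying in \<open>F x\<close> keeps \<open>f z\<close> finite. Hence the infimum
    over \<open>F z\<close> is finite too, and adding \<open>e\<close> increases it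
    strictly.\<close>
  have step: "\<exists>y. y \<in> F x \<and> y \<in> F z \<and> (\<forall>w\<in>F z. f y \<le> f w + ereal e)"
    if z: "z \<in> F x" and e: "e > 0" for z e
  proof -
    let ?i = "INF w\<in>F z. f w"
    have "ereal c \<le> ?i" using below by (intro INF_greatest)
    moreover have "?i \<le> f z" using F_self by (rule INF_lower)
    moreover have "f z < \<infinity>" using F_le[OF z] x by auto
    ultimately have "?i < ?i + ereal e" using e by (cases ?i) auto
    then obtain y where y: "y \<in> F z" "f y < ?i + ereal e"
      unfolding INF_less_iff by blast
    have "f y \<le> f w + ereal e" if "w \<in> F z" for w
      using y(2) INF_lower[OF that, of f] by (meson add_right_mono le_less_trans less_imp_le order_trans)
    then show ?thesis using y F_trans[OF z] by blast
  qed
  have "\<exists>s. \<forall>n::nat. (s n \<in> F x \<and> (n = 0 \<longrightarrow> s n = x)) \<and>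
      (s (Suc n) \<in> F (s n) \<and> (\<forall>w\<in>F (s n). f (s (Suc n)) \<le> f w + ereal ((1/2)^n)))"
    using F_self by (intro dependent_nat_choice) (use step in \<open>auto simp: Bex_def\<close>)
  then obtain s where sx: "\<And>n. s n \<in> F x" and s0: "s 0 = x"
    and s_Suc: "\<And>n. s (Suc n) \<in> F (s n)"
    and s_min: "\<And>n w. w \<in> F (s n) \<Longrightarrow> f (s (Suc n)) \<le> f w + ereal ((1/2)^n)"
    by blast
  \<comment> \<open>Such a \<open>w\<close> also lies in \<open>F (s n)\<close>, on which
    \<open>s (Suc n)\<close> is minimal up to \<open>(1/2)^n\<close>. So \<open>f\<close> can drop
    by at most that much from \<open>s (Suc n)\<close> to \<open>w\<close>, while lying in
    \<open>F (s (Suc n))\<close> costs a drop of at least \<sigma> times the distance.\<close>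
  have close: "dist w (s (Suc n)) \<le> (1/2)^n / \<sigma>" if "w \<in> F (s (Suc n))" for w n
  proof -
    have "f w + ereal (\<sigma> * dist w (s (Suc n))) \<le> f w + ereal ((1/2)^n)"
      using that s_min[of w n] F_trans[OF s_Suc[of n]] unfolding F_def by (auto intro: order_trans)
    moreover have "f w < \<infinity>" using F_le[OF that] F_le[OF sx[of "Suc n"]] x by auto
    ultimately have "\<sigma> * dist w (s (Suc n)) \<le> (1/2)^n"
      using below[of w] by (cases "f w") auto
    then show ?thesis using \<sigma> by (simp add: field_simps)
  qed
  have lim0: "(\<lambda>n. (1/2)^n / \<sigma>) \<longlonglongrightarrow> 0"
    by (intro tendsto_divide_zero LIMSEQ_realpow_zero) auto
  \<comment> \<open>Cantor's intersection theorem. The indices start at \<open>Suc n\<close> because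
    the estimate \<open>close\<close> holds from there on.\<close>
  have "\<exists>v. (\<Inter>n. F (s (Suc n))) = {v}"
  proof (rule decreasing_closed_nest_sing)
    show "closed (F (s (Suc n)))" for n
    proof -
      obtain a where "f (s (Suc n)) = ereal a"
        using F_le[OF sx[of "Suc n"]] x below[of "s (Suc n)"] by (cases "f (s (Suc n))") auto
      then show ?thesis unfolding F_def
        by (auto intro!: closed_sublevel_lower_semicontinuous_add lsc continuous_intros)
    qed
    show "F (s (Suc n)) \<noteq> {}" for n using F_self by blast
    show "F (s (Suc n)) \<subseteq> F (s (Suc m))" if "m \<le> n" for m n
      using that by (induction rule: dec_induct) (use F_trans[OF s_Suc] in blast)+
    fix e :: real assume "0 < e"
    then have "\<forall>\<^sub>F n in sequentially. (1/2)^n / \<sigma> < e / 2"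
      by (intro order_tendstoD(2)[OF lim0]) simp
    then obtain n where n: "(1/2)^n / \<sigma> < e / 2" by (auto dest: eventually_happens)
    have "dist y z < e" if "y \<in> F (s (Suc n))" "z \<in> F (s (Suc n))" for y z
      using close[OF that(1)] close[OF that(2)] n dist_triangle2[of y z "s (Suc n)"]
      by linarith
    then show "\<exists>n. \<forall>y\<in>F (s (Suc n)). \<forall>z\<in>F (s (Suc n)). dist y z < e" by blast
  qed
  then obtain v where v: "(\<Inter>n. F (s (Suc n))) = {v}" ..
  show thesis
  proof
    have "v \<in> F x" using v F_trans[OF sx] by blast
    then show "f v + ereal (\<sigma> * dist v x) \<le> f x" by (simp add: F_def)
    fix w assume "w \<noteq> v"
    \<comment> \<open>By transitivity a point of \<open>F v\<close> lies in every
      \<open>F (s (Suc n))\<close>, whose only common point is \<open>v\<close>.\<close>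
    then have "w \<notin> F v" using v F_trans[of v] by blast
    then show "f v < f w + ereal (\<sigma> * dist w v)" by (simp add: F_def)
  qed
qed

section \<open>Polarization and symmetrization in the norm of \<open>'v\<close>\<close>

context symmetrization_framework
begin

lemma iterated_polarization_in_S:
  "u \<in> S \<Longrightarrow> set Hs \<subseteq> HH \<Longrightarrow> iterated_polarization pol u Hs \<in> S"
  unfolding iterated_polarization_def by (induction Hs arbitrary: u) (auto simp: pol_in_S)

lemma star_iterated_polarization:
  "u \<in> S \<Longrightarrow> set Hs \<subseteq> HH \<Longrightarrow> star (iterated_polarization pol u Hs) = star u"
  unfolding iterated_polarization_def
  by (induction Hs arbitrary: u) (auto simp: pol_in_S star_pol)

lemma iterated_polarization_contraction:
  assumes "u \<in> S" "v \<in> S" "set Hs \<subseteq> HH"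
  shows "norm (iV (iterated_polarization pol u Hs) - iV (iterated_polarization pol v Hs))
    \<le> norm (iV u - iV v)"
  using assms unfolding iterated_polarization_def
proof (induction Hs arbitrary: u v)
  case (Cons H Hs)
  then show ?case
    by (auto simp: pol_in_S intro: order_trans[OF Cons.IH pol_contraction])
qed simp

lemma iterated_polarization_decreasing:
  fixes g :: "'x \<Rightarrow> ereal"
  assumes "\<And>u H. u \<in> S \<Longrightarrow> H \<in> HH \<Longrightarrow> g (pol u H) \<le> g u" "u \<in> S" "set Hs \<subseteq> HH"
  shows "g (iterated_polarization pol u Hs) \<le> g u"
  using assms(2,3) unfolding iterated_polarization_def
proof (induction Hs arbitrary: u)
  case (Cons H Hs)
  then show ?case by (auto simp: pol_in_S intro: order_trans[OF Cons.IH assms(1)])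
qed simp

text \<open>One sequence of polarizations serves all points of \<open>S\<close>, so the contraction
  estimate for \<open>u\<close> and \<open>v\<close> can be passed to the limit along the same
  sequence.\<close>

lemma star_contraction:
  assumes "u \<in> S" "v \<in> S"
  shows "norm (iV (star u) - iV (star v)) \<le> norm (iV u - iV v)"
proof -
  obtain Hseq :: "nat \<Rightarrow> 'h" where Hseq: "\<And>m. Hseq m \<in> HH"
    and lim: "\<And>u. u \<in> S \<Longrightarrow>
      (\<lambda>m. iV (iterated_polarization pol u (map Hseq [1..<Suc m]))) \<longlonglongrightarrow> iV (star u)"
    using polarizations_converge by blast
  show ?thesis
    using Hseq assms
    by (intro LIMSEQ_le_const2[OF tendsto_norm[OF tendsto_diff[OF lim lim]]] exI allI impI
        iterated_polarization_contraction) auto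
qed

text \<open>The approximating sequence is constant, so \<open>iV (star u) = iV u\<close>;
  injectivity of \<open>iV\<close> brings the equality back to \<open>'x\<close>.\<close>

lemma star_eq_of_polarization_fixed:
  assumes "u \<in> polarization_fixed S HH pol"
  shows "star u = u"
proof -
  have u: "u \<in> S" "\<And>H. H \<in> HH \<Longrightarrow> pol u H = u"
    using assms by (auto simp: polarization_fixed_def)
  have fixed: "iterated_polarization pol u Hs = u" if "set Hs \<subseteq> HH" for Hs
    using that unfolding iterated_polarization_def by (induction Hs) (auto simp: u)
  obtain Hseq :: "nat \<Rightarrow> 'h" where Hseq: "\<And>m. Hseq m \<in> HH"
    and "(\<lambda>m. iV (iterated_polarization pol u (map Hseq [1..<Suc m]))) \<longlonglongrightarrow> iV (star u)"
    using polarizations_converge u(1) by blast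
  moreover have "iterated_polarization pol u (map Hseq [1..<Suc m]) = u" for m
    using Hseq by (intro fixed) auto
  ultimately have "iV (star u) = iV u" by (simp add: LIMSEQ_const_iff)
  then show ?thesis using iV(2) by (simp add: inj_eq)
qed

text \<open>Go from \<open>v\<close> through \<open>x\<close> and \<open>star x\<close> to
  \<open>star (\<Theta> v)\<close>. The three distances are bounded by \<open>K * r\<close>
  (embedding), \<open>r\<close> (asymmetry of \<open>x\<close>) and \<open>C\<Theta> * K * r\<close>
  (\<open>star\<close> is a contraction, \<Theta> is Lipschitz and fixes \<open>x\<close>), which
  add up to the constant.\<close>

lemma asymmetry_near:
  assumes x: "x \<in> S" "norm (iV x - iV (star x)) < r" and v: "norm (v - x) \<le> r"
  shows "norm (iV v - iV (star (\<Theta> v))) < (K * (C\<Theta> + 1) + 1) * r"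
proof -
  have "norm (iV v - iV x) \<le> K * norm (v - x)"
    using K_bound[of "v - x"] iV(1) by (simp add: linear_simps)
  also have "\<dots> \<le> K * r" using K_pos v by simp
  finally have vx: "norm (iV v - iV x) \<le> K * r" .
  have "norm (iV (star x) - iV (star (\<Theta> v))) \<le> norm (iV (\<Theta> x) - iV (\<Theta> v))"
    using star_contraction[OF x(1) \<Theta>_in_S[of v]] by (simp add: \<Theta>_id x(1))
  also have "\<dots> \<le> C\<Theta> * norm (iV v - iV x)"
    using \<Theta>_lipschitz[of x v] by (simp add: norm_minus_commute)
  also have "\<dots> \<le> C\<Theta> * (K * r)" using vx C\<Theta>_pos by simp
  finally have "norm (iV (star x) - iV (star (\<Theta> v))) \<le> C\<Theta> * (K * r)" .
  moreover have "norm (iV v - iV (star (\<Theta> v)))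
      \<le> norm (iV v - iV x) + norm (iV x - iV (star x)) + norm (iV (star x) - iV (star (\<Theta> v)))"
    by norm
  ultimately have "norm (iV v - iV (star (\<Theta> v))) < K * r + r + C\<Theta> * (K * r)"
    using vx x(2) by linarith
  then show ?thesis by (simp add: algebra_simps)
qed

text \<open>Used twice: with radius \<delta> at a polarized point for \<open>fh h\<close>, and with
  radius \<rho> at a polarization-fixed \<open>y\<close> for \<open>f\<close>.\<close>

lemma ekeland_near_symmetric:
  assumes g: "proper_lsc_bounded_below g" and \<sigma>: "\<sigma> > 0"
    and x: "x \<in> S" "norm (iV x - iV (star x)) < r" and gx: "g x < (INF u. g u) + ereal (\<sigma> * r)"
  obtains v where "norm (iV v - iV (star (\<Theta> v))) < (K * (C\<Theta> + 1) + 1) * r"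
    and "g v \<le> g x" and "norm (v - x) < r"
    and "\<And>w. g w \<ge> g v - ereal (\<sigma> * norm (w - v))"
proof -
  obtain c where lsc: "lower_semicontinuous g" and c: "\<And>u. ereal c \<le> g u"
    using g by (auto simp: proper_lsc_bounded_below_def)
  have fin: "g x < \<infinity>" using gx by auto
  obtain v where v: "g v + ereal (\<sigma> * dist v x) \<le> g x"
    and min: "\<And>w. w \<noteq> v \<Longrightarrow> g v < g w + ereal (\<sigma> * dist w v)"
    using ekeland_variational_principle[OF lsc c fin \<sigma>] by blast
  have gv: "g v \<le> g x"
    using v \<sigma> c[of v] by (cases "g v"; cases "g x") (auto intro: order_trans[rotated])
  \<comment> \<open>The drop from \<open>g x\<close> to \<open>g v\<close> is less than
    \<open>\<sigma> * r\<close>, since \<open>g x\<close> exceeds the infimum by less; this forces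
    \<open>v\<close> strictly within \<open>r\<close> of \<open>x\<close>.\<close>
  have "(INF u. g u) \<le> g v" by (rule INF_lower) simp
  then have "g v + ereal (\<sigma> * dist v x) < g v + ereal (\<sigma> * r)"
    using v gx by (meson add_right_mono le_less_trans less_le_trans)
  then have "\<sigma> * dist v x < \<sigma> * r" using c[of v] by (cases "g v") auto
  then have near: "norm (v - x) < r" using \<sigma> by (simp add: dist_norm)
  have "g w \<ge> g v - ereal (\<sigma> * norm (w - v))" for w
  proof (cases "w = v")
    case False
    from min[OF this] show ?thesis
      using c[of v] c[of w] by (cases "g v"; cases "g w") (auto simp: dist_norm)
  qed simp
  then show thesis using that asymmetry_near[OF x less_imp_le[OF near]] gv near by blast
qed

end

section \<open>Recovery sequences and the choice of the constants\<close>

theorem theorem2p11: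
  fixes iV :: "'x::banach \<Rightarrow> 'v::banach"
    and iW :: "'v \<Rightarrow> 'w::banach"
    and K C\<Theta> :: real
    and S :: "'x set"
    and HH :: "'h::topological_space set"
    and star :: "'x \<Rightarrow> 'x"
    and pol :: "'x \<Rightarrow> 'h \<Rightarrow> 'x"
    and \<Theta> :: "'x \<Rightarrow> 'x"
    and f :: "'x \<Rightarrow> ereal"
    and fh :: "nat \<Rightarrow> 'x \<Rightarrow> ereal"
    and Y :: "'x set"
    and \<rho> \<sigma> :: real
  assumes framework: "symmetrization_framework iV iW K S HH star pol \<Theta> C\<Theta>"
    and f: "proper_lsc_bounded_below f"
    and fh: "\<And>h. proper_lsc_bounded_below (fh h)"
    and recovery: "\<And>u. u \<in> dom_fin f \<inter> S \<Longrightarrow>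
          \<exists>us. (\<forall>h. us h \<in> S) \<and> us \<longlonglongrightarrow> u \<and> (\<lambda>h. fh h (us h)) \<longlonglongrightarrow> f u"
    and liminf_inf: "liminf (\<lambda>h. INF u. fh h u) \<ge> (INF u. f u)"
    and pol_decreasing: "\<And>h u H. u \<in> S \<Longrightarrow> H \<in> HH \<Longrightarrow> fh h (pol u H) \<le> fh h u"
    and Y: "Y \<noteq> {}" "Y \<subseteq> S"
    and pos: "\<rho> > 0" "\<sigma> > 0"
    and inf_Y: "(INF u\<in>Y. f u) < (INF u. f u) + ereal (\<sigma> * \<rho>)"
  shows "(\<forall>T. symmetrization_approximation iV S HH star pol T \<longrightarrow>
            (\<forall>h0\<ge>1. \<exists>h\<ge>h0. \<exists>m::nat. m > 1 \<and> (\<exists>u\<in>S. \<exists>v.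
               norm (iV v - iV (star (\<Theta> v))) < (K * (C\<Theta> + 1) + 1) * \<rho> \<and>
               \<bar>fh h v - (INF u. f u)\<bar> < ereal (\<sigma> * \<rho>) \<and>
               infdist v Y < \<rho> + norm (T ((real m - 1) * \<rho> / real m) u - u) \<and>
               (\<forall>w. fh h w \<ge> fh h v - ereal (\<sigma> * norm (w - v))))))
       \<and> ((\<forall>h. fh h = f) \<and> Y \<subseteq> polarization_fixed S HH pol \<longrightarrow>
            (\<exists>v.
               norm (iV v - iV (star (\<Theta> v))) < (K * (C\<Theta> + 1) + 1) * \<rho> \<and>
               \<bar>f v - (INF u. f u)\<bar> < ereal (\<sigma> * \<rho>) \<and>
               infdist v Y < \<rho> \<and>
               (\<forall>w. f w \<ge> f v - ereal (\<sigma> * norm (w - v)))))"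
proof -
  interpret symmetrization_framework iV iW K S HH star pol \<Theta> C\<Theta> by (rule framework)
  define i where "i = (INF u. f u)"
  obtain y where y: "y \<in> Y" "f y < i + ereal (\<sigma> * \<rho>)"
    using inf_Y unfolding i_def INF_less_iff by blast
  have "i \<le> f y" unfolding i_def by (rule INF_lower) simp
  obtain c where "\<And>u. ereal c \<le> f u" using f by (auto simp: proper_lsc_bounded_below_def)
  then have "ereal c \<le> i" unfolding i_def by (intro INF_greatest)
  obtain \<iota> where \<iota>: "i = ereal \<iota>"
    using y(2) \<open>ereal c \<le> i\<close> \<open>i \<le> f y\<close> by (cases i) auto
  obtain b where b: "f y = ereal b" "\<iota> \<le> b" "b < \<iota> + \<sigma> * \<rho>"
    using y(2) \<open>i \<le> f y\<close> by (cases "f y") (auto simp: \<iota>)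
  have yS: "y \<in> S" using y(1) Y(2) by blast
  have "\<exists>h\<ge>h0. \<exists>m::nat. m > 1 \<and> (\<exists>u\<in>S. \<exists>v.
      norm (iV v - iV (star (\<Theta> v))) < (K * (C\<Theta> + 1) + 1) * \<rho> \<and>
      \<bar>fh h v - i\<bar> < ereal (\<sigma> * \<rho>) \<and>
      infdist v Y < \<rho> + norm (T ((real m - 1) * \<rho> / real m) u - u) \<and>
      (\<forall>w. fh h w \<ge> fh h v - ereal (\<sigma> * norm (w - v))))"
    if T: "symmetrization_approximation iV S HH star pol T" for T and h0 :: nat
  proof -
    \<comment> \<open>The gap \<open>b - \<iota>\<close> is strictly below
      \<open>\<sigma> * \<rho>\<close>, so for large \<open>m\<close> the smaller radius \<delta>
      still dominates it. The remaining \<open>\<rho> - \<delta>\<close> is spent on the distance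
      from the recovery sequence to \<open>y\<close>.\<close>
    have "(\<lambda>m. \<sigma> * ((real m - 1) * \<rho> / real m)) \<longlonglongrightarrow> \<sigma> * \<rho>" by real_asymp
    then have "\<forall>\<^sub>F m in sequentially. b - \<iota> < \<sigma> * ((real m - 1) * \<rho> / real m)"
      using b(3) by (intro order_tendstoD(1)) auto
    then have "\<forall>\<^sub>F m in sequentially. b - \<iota> < \<sigma> * ((real m - 1) * \<rho> / real m) \<and> m > 1"
      using eventually_gt_at_top[of 1] by eventually_elim simp
    then obtain m where m: "m > 1" "b - \<iota> < \<sigma> * ((real m - 1) * \<rho> / real m)"
      by (auto dest: eventually_happens)
    define \<delta> where "\<delta> = (real m - 1) * \<rho> / real m"
    have \<delta>: "0 < \<delta>" "\<delta> < \<rho>" "b - \<iota> < \<sigma> * \<delta>"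
      using m pos by (auto simp: \<delta>_def field_simps)
    \<comment> \<open>Half of the slack: raising \<open>b\<close> and lowering \<iota> by \<epsilon>
      makes the gap exactly \<open>\<sigma> * \<delta>\<close>, as Ekeland's principle with radius
      \<delta> allows.\<close>
    define \<epsilon> where "\<epsilon> = (\<sigma> * \<delta> - (b - \<iota>)) / 2"
    have \<epsilon>: "\<epsilon> > 0" "(b + \<epsilon>) - (\<iota> - \<epsilon>) = \<sigma> * \<delta>"
      using \<delta>(3) by (auto simp: \<epsilon>_def field_simps)
    obtain us where us: "\<And>h. us h \<in> S" "us \<longlonglongrightarrow> y" "(\<lambda>h. fh h (us h)) \<longlonglongrightarrow> f y"
      using recovery[of y] yS b by (auto simp: dom_fin_def)
    have "\<forall>\<^sub>F h in sequentially. fh h (us h) < ereal (b + \<epsilon>)"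
      using \<epsilon>(1) b by (intro order_tendstoD(2)[OF us(3)]) auto
    moreover have "\<forall>\<^sub>F h in sequentially. ereal (\<iota> - \<epsilon>) < (INF u. fh h u)"
    proof (rule less_LiminfD)
      show "ereal (\<iota> - \<epsilon>) < liminf (\<lambda>h. INF u. fh h u)"
        using \<epsilon>(1) by (intro less_le_trans[OF _ liminf_inf]) (simp flip: i_def add: \<iota>)
    qed
    moreover have "\<forall>\<^sub>F h in sequentially. dist (us h) y < \<rho> - \<delta>"
      using us(2) \<delta>(2) by (intro tendstoD) auto
    ultimately have "\<forall>\<^sub>F h in sequentially. fh h (us h) < ereal (b + \<epsilon>) \<and>
        ereal (\<iota> - \<epsilon>) < (INF u. fh h u) \<and> dist (us h) y < \<rho> - \<delta> \<and> h \<ge> h0"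
      using eventually_ge_at_top[of h0] by eventually_elim simp
    then obtain h where h: "fh h (us h) < ereal (b + \<epsilon>)" "ereal (\<iota> - \<epsilon>) < (INF u. fh h u)"
        "dist (us h) y < \<rho> - \<delta>" "h \<ge> h0"
      by (auto dest: eventually_happens)
    define u where "u = us h"
    have u: "u \<in> S" unfolding u_def by (rule us)
    obtain Hs where Hs: "set Hs \<subseteq> HH" "T \<delta> u = iterated_polarization pol u Hs"
      and near: "norm (iV (T \<delta> u) - iV (star u)) < \<delta>"
      using T \<delta>(1) u unfolding symmetrization_approximation_def by blast
    have TS: "T \<delta> u \<in> S" unfolding Hs(2) using u Hs(1) by (rule iterated_polarization_in_S)
    \<comment> \<open>\<open>T \<delta> u\<close> arises from \<open>u\<close> by polarizations,
      which leave \<open>star\<close> unchanged, so closeness to \<open>star u\<close> is closeness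
      to its own symmetrization.\<close>
    have sym: "norm (iV (T \<delta> u) - iV (star (T \<delta> u))) < \<delta>"
      using near star_iterated_polarization[OF u Hs(1)] by (simp add: Hs(2))
    have "fh h (T \<delta> u) \<le> fh h u"
      unfolding Hs(2) using pol_decreasing u Hs(1) by (rule iterated_polarization_decreasing)
    then have low: "fh h (T \<delta> u) < ereal (b + \<epsilon>)" using h(1) by (simp add: u_def)
    also have "\<dots> = ereal (\<iota> - \<epsilon>) + ereal (\<sigma> * \<delta>)" using \<epsilon>(2) by simp
    also have "\<dots> \<le> (INF u. fh h u) + ereal (\<sigma> * \<delta>)"
      using h(2) by (intro add_right_mono) simp
    finally obtain v where v: "norm (iV v - iV (star (\<Theta> v))) < (K * (C\<Theta> + 1) + 1) * \<delta>"
        "fh h v \<le> fh h (T \<delta> u)" "norm (v - T \<delta> u) < \<delta>"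
        "\<And>w. fh h w \<ge> fh h v - ereal (\<sigma> * norm (w - v))"
      using ekeland_near_symmetric[OF fh pos(2) TS sym] by blast
    have "(K * (C\<Theta> + 1) + 1) * \<delta> \<le> (K * (C\<Theta> + 1) + 1) * \<rho>"
      using K_pos C\<Theta>_pos \<delta>(2) by (intro mult_left_mono) auto
    then have 1: "norm (iV v - iV (star (\<Theta> v))) < (K * (C\<Theta> + 1) + 1) * \<rho>"
      using v(1) by simp
    \<comment> \<open>The infimum of \<open>fh h\<close> may lie below \<open>i\<close>, hence the
      two-sided estimate: the value at \<open>v\<close> is between
      \<open>\<iota> - \<epsilon>\<close> and
      \<open>b + \<epsilon> = \<iota> - \<epsilon> + \<sigma> * \<delta>\<close>.\<close>
    have "ereal (\<iota> - \<epsilon>) < fh h v" using h(2) by (rule less_le_trans) (simp add: INF_lower)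
    moreover have "fh h v < ereal (b + \<epsilon>)" using v(2) low by simp
    moreover have "b + \<epsilon> < \<iota> + \<sigma> * \<rho>" "\<epsilon> < \<sigma> * \<rho>"
      using \<epsilon> b(2) mult_strict_left_mono[OF \<delta>(2) pos(2)] by linarith+
    ultimately have 2: "\<bar>fh h v - i\<bar> < ereal (\<sigma> * \<rho>)"
      by (cases "fh h v") (auto simp: \<iota> abs_less_iff)
    have "infdist v Y \<le> dist v y" using y(1) by (rule infdist_le)
    \<comment> \<open>The outer terms are below \<delta> and \<open>\<rho> - \<delta>\<close>; the
      middle one stays in the conclusion.\<close>
    also have "\<dots> \<le> norm (v - T \<delta> u) + norm (T \<delta> u - u) + dist u y"
      unfolding dist_norm by norm
    also have "\<dots> < \<rho> + norm (T \<delta> u - u)" using v(3) h(3) by (simp add: u_def)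
    finally have 3: "infdist v Y < \<rho> + norm (T ((real m - 1) * \<rho> / real m) u - u)"
      unfolding \<delta>_def .
    show ?thesis using h(4) m(1) u 1 2 3 v(4) by blast
  qed
  moreover have "\<exists>v. norm (iV v - iV (star (\<Theta> v))) < (K * (C\<Theta> + 1) + 1) * \<rho> \<and>
      \<bar>f v - i\<bar> < ereal (\<sigma> * \<rho>) \<and> infdist v Y < \<rho> \<and>
      (\<forall>w. f w \<ge> f v - ereal (\<sigma> * norm (w - v)))"
    if "Y \<subseteq> polarization_fixed S HH pol"
  proof -
    \<comment> \<open>Here \<open>y\<close> is its own symmetrization and can itself start Ekeland's
      principle with the full radius \<rho>, so no displacement by \<open>T\<close> enters the
      distance to \<open>Y\<close>.\<close>
    have "star y = y" using that y(1) by (intro star_eq_of_polarization_fixed) blast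
    then have "norm (iV y - iV (star y)) < \<rho>" using pos by simp
    then obtain v where v: "norm (iV v - iV (star (\<Theta> v))) < (K * (C\<Theta> + 1) + 1) * \<rho>"
        "f v \<le> f y" "norm (v - y) < \<rho>" "\<And>w. f w \<ge> f v - ereal (\<sigma> * norm (w - v))"
      using ekeland_near_symmetric[OF f pos(2) yS] y(2) unfolding i_def by blast
    have "i \<le> f v" unfolding i_def by (rule INF_lower) simp
    then have "\<bar>f v - i\<bar> < ereal (\<sigma> * \<rho>)"
      using v(2) b by (cases "f v") (auto simp: \<iota>)
    moreover have "infdist v Y < \<rho>"
      using infdist_le[OF y(1), of v] v(3) by (simp add: dist_norm)
    ultimately show ?thesis using v by blast
  qed
  ultimately show ?thesis unfolding i_def by blast
qed

end
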